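(* Let $f\colon\{-1,1\}^{nk}\to\{-1,1\}$ be given by $f(x)=\mathrm{sign}\left(1+\sum_{i=1}^n\sum_{j=1}^k2^ix_{ij}\right)$. Then $R^+(f,64k\lceil\log k\rceil+1)=0$. In addition, for all integers $d\geq1$, $R^+(f,d)\leq1-(k2^{n+1})^{-1/d}$.
   Context: $R^+(f,d)=\inf_{p,q}\max_{x}|f(x)-p(x)/q(x)|$, the infimum over real polynomials $p,q$ of total degree at most $d$ with $q$ positive on the domain of $f$. $\log$ is to base $2$. *)

theory Defs
  imports Complex_Main "HOL-Library.FuncSet" "HOL-Library.Poly_Mapping"
begin

text \<open>Real multivariate polynomials: an exponent vector \<open>'v \<Rightarrow>\<^sub>0 nat\<close> is a monomial,
  and a polynomial is a finitely supported real-valued function on monomials.\<close>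

type_synonym 'v rmpoly = "('v \<Rightarrow>\<^sub>0 nat) \<Rightarrow>\<^sub>0 real"

definition monom_degree :: "('v \<Rightarrow>\<^sub>0 nat) \<Rightarrow> nat" where
  "monom_degree m = (\<Sum>v\<in>Poly_Mapping.keys m. Poly_Mapping.lookup m v)"

definition monom_eval :: "('v \<Rightarrow>\<^sub>0 nat) \<Rightarrow> ('v \<Rightarrow> real) \<Rightarrow> real" where
  "monom_eval m x = (\<Prod>v\<in>Poly_Mapping.keys m. x v ^ Poly_Mapping.lookup m v)"

definition poly_vars :: "'v rmpoly \<Rightarrow> 'v set" where
  "poly_vars p = (\<Union>m\<in>Poly_Mapping.keys p. Poly_Mapping.keys m)"

text \<open>The zero polynomial gets total degree \<open>0\<close>.\<close>

definition total_degree :: "'v rmpoly \<Rightarrow> nat" where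
  "total_degree p = Max (insert 0 (monom_degree ` Poly_Mapping.keys p))"

definition poly_eval :: "'v rmpoly \<Rightarrow> ('v \<Rightarrow> real) \<Rightarrow> real" where
  "poly_eval p x = (\<Sum>m\<in>Poly_Mapping.keys p. Poly_Mapping.lookup p m * monom_eval m x)"

definition polys_upto :: "'v set \<Rightarrow> nat \<Rightarrow> 'v rmpoly set" where
  "polys_upto I d = {p. poly_vars p \<subseteq> I \<and> total_degree p \<le> d}"

text \<open>\<open>Rplus I X f d\<close> is \<open>R\<^sup>+(f, d)\<close> for a function \<open>f\<close> whose domain is the finite nonempty set
  \<open>X\<close> of points with coordinates indexed by \<open>I\<close>. For such \<open>X\<close> the maximum exists, and the
  infimum is over a nonempty set (take \<open>p = 0\<close>, \<open>q = 1\<close>) that is bounded below by \<open>0\<close>.\<close>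

definition Rplus :: "'v set \<Rightarrow> ('v \<Rightarrow> real) set \<Rightarrow> (('v \<Rightarrow> real) \<Rightarrow> real) \<Rightarrow> nat \<Rightarrow> real" where
  "Rplus I X f d =
     Inf {Max ((\<lambda>x. \<bar>f x - poly_eval p x / poly_eval q x\<bar>) ` X) | p q.
            p \<in> polys_upto I d \<and> q \<in> polys_upto I d \<and> (\<forall>x\<in>X. poly_eval q x > 0)}"

definition sign_cube :: "'v set \<Rightarrow> ('v \<Rightarrow> real) set" where
  "sign_cube I = I \<rightarrow>\<^sub>E {-1, 1}"

definition halfspace :: "nat \<Rightarrow> nat \<Rightarrow> (nat \<times> nat \<Rightarrow> real) \<Rightarrow> real" where
  "halfspace n k x = sgn (1 + (\<Sum>i=1..n. \<Sum>j=1..k. 2 ^ i * x (i, j)))"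

text \<open>On the cube the argument of \<open>sgn\<close> is an odd integer, so the value \<open>sgn 0 = 0\<close> is not taken.\<close>

lemma halfspace_range:
  assumes "x \<in> sign_cube ({1..n} \<times> {1..k})"
  shows "halfspace n k x \<in> {-1, 1}"
proof -
  have "\<exists>z::int. x (i, j) = of_int z" if "i \<in> {1..n}" "j \<in> {1..k}" for i j
  proof -
    have "x (i, j) \<in> {-1, 1}"
      using assms that by (auto simp: sign_cube_def PiE_def Pi_def)
    then have "x (i, j) = of_int (-1) \<or> x (i, j) = of_int 1" by auto
    then show ?thesis by blast
  qed
  then obtain y :: "nat \<Rightarrow> nat \<Rightarrow> int"
    where y: "\<And>i j. i \<in> {1..n} \<Longrightarrow> j \<in> {1..k} \<Longrightarrow> x (i, j) = of_int (y i j)"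
    by metis
  define S where "S = (\<Sum>i=1..n. \<Sum>j=1..k. 2 ^ i * y i j)"
  have "even S" unfolding S_def by (intro dvd_sum) auto
  then have "1 + S \<noteq> 0" by presburger
  moreover have "(\<Sum>i=1..n. \<Sum>j=1..k. 2 ^ i * x (i, j)) = of_int S"
    unfolding S_def by (simp add: y)
  ultimately show ?thesis
    unfolding halfspace_def by (auto simp: sgn_if)
qed

end

theory Submission
  imports Defs "HOL-Computational_Algebra.Polynomial"
begin

text \<open>
  Write \<open>t = 1 + \<Sum>\<^sub>i 2\<^sup>i s\<^sub>i\<close> with \<open>s\<^sub>i = \<Sum>\<^sub>j x\<^sub>i\<^sub>j\<close>, so that \<open>f = sgn t\<close> and \<open>1 \<le> \<bar>t\<bar> \<le> k 2\<^sup>n\<^sup>+\<^sup>1\<close>.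

  The bound for arbitrary \<open>d\<close> is Newman's construction: with \<open>P(t) = \<Prod>\<^sub>i (t + N\<^sup>i\<^sup>-\<^sup>1\<^sup>/\<^sup>2)\<close>, \<open>i \<le> d\<close>, and
  \<open>N\<^sup>d = k 2\<^sup>n\<^sup>+\<^sup>1\<close>, the quotient \<open>(P(t) - P(-t)) / (P(t) + P(-t))\<close> is odd and lies between \<open>N\<^sup>-\<^sup>1\<^sup>/\<^sup>2\<close> and
  \<open>N\<^sup>1\<^sup>/\<^sup>2\<close> for \<open>1 \<le> t \<le> N\<^sup>d\<close>.

  For error zero, evaluate \<open>t\<close> by Horner's rule from the most significant layer, with prefix values
  \<open>U\<^sub>0, \<dots>, U\<^sub>n = t\<close>. Once \<open>\<bar>U\<^sub>l\<bar> \<ge> k\<close>, the sign never changes again, and at the first such \<open>l\<close> the integer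
  \<open>U\<^sub>l\<close> is smaller than \<open>3 k\<close> in absolute value. Hence polynomials \<open>a\<^sub>l\<close>, \<open>b\<^sub>l\<close> of degree less than \<open>6 k\<close>
  can be interpolated so that both vanish at \<open>U\<^sub>l\<close> while the sign is undecided, and \<open>a\<^sub>l = f\<close>, \<open>b\<^sub>l = 1\<close>
  when it is first decided. As \<open>e \<rightarrow> 0\<close>, the quotient \<open>\<Sum> e\<^sup>l a\<^sub>l / \<Sum> e\<^sup>l b\<^sub>l\<close> tends to \<open>f\<close> on the cube.
\<close>

section \<open>Functions given by polynomials of bounded degree\<close>

text \<open>Degrees are tracked on the level of functions, so that closure rules replace work with
  coefficients. Agreement is required at every point, not only on the cube.\<close>

definition poly_fun :: "'v set \<Rightarrow> nat \<Rightarrow> (('v \<Rightarrow> real) \<Rightarrow> real) \<Rightarrow> bool" where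
  "poly_fun I d F \<longleftrightarrow> (\<exists>p\<in>polys_upto I d. \<forall>x. poly_eval p x = F x)"

lemma monom_eval_superset:
  assumes "finite A" "Poly_Mapping.keys m \<subseteq> A"
  shows "monom_eval m x = (\<Prod>v\<in>A. x v ^ Poly_Mapping.lookup m v)"
  unfolding monom_eval_def
  by (rule prod.mono_neutral_left) (use assms in \<open>auto simp: in_keys_iff\<close>)

lemma monom_degree_superset:
  assumes "finite A" "Poly_Mapping.keys m \<subseteq> A"
  shows "monom_degree m = (\<Sum>v\<in>A. Poly_Mapping.lookup m v)"
  unfolding monom_degree_def
  by (rule sum.mono_neutral_left) (use assms in \<open>auto simp: in_keys_iff\<close>)

text \<open>Coefficients may cancel in a sum, so its keys can form a proper subset of the union of
  keys; extra terms with coefficient 0 do no harm.\<close>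

lemma poly_eval_superset:
  assumes "finite A" "Poly_Mapping.keys p \<subseteq> A"
  shows "poly_eval p x = (\<Sum>m\<in>A. Poly_Mapping.lookup p m * monom_eval m x)"
  unfolding poly_eval_def
  by (rule sum.mono_neutral_left) (use assms in \<open>auto simp: in_keys_iff\<close>)

lemma monom_eval_add: "monom_eval (m + m') x = monom_eval m x * monom_eval m' x"
  using Poly_Mapping.keys_add[of m m']
  by (simp add: monom_eval_superset[of "Poly_Mapping.keys m \<union> Poly_Mapping.keys m'"]
      lookup_add power_add prod.distrib)

lemma monom_degree_add: "monom_degree (m + m') = monom_degree m + monom_degree m'"
  using Poly_Mapping.keys_add[of m m']
  by (simp add: monom_degree_superset[of "Poly_Mapping.keys m \<union> Poly_Mapping.keys m'"]
      lookup_add sum.distrib)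

lemma poly_eval_add: "poly_eval (p + q) x = poly_eval p x + poly_eval q x"
  using Poly_Mapping.keys_add[of p q]
  by (simp add: poly_eval_superset[of "Poly_Mapping.keys p \<union> Poly_Mapping.keys q"]
      lookup_add sum.distrib algebra_simps)

lemma polys_upto_iff:
  "p \<in> polys_upto I d \<longleftrightarrow>
     (\<forall>m\<in>Poly_Mapping.keys p. Poly_Mapping.keys m \<subseteq> I \<and> monom_degree m \<le> d)"
  by (auto simp: polys_upto_def poly_vars_def total_degree_def)

lemma poly_fun_monom:
  assumes "Poly_Mapping.keys m \<subseteq> I" "monom_degree m \<le> d"
  shows "poly_fun I d (\<lambda>x. c * monom_eval m x)"
proof -
  have "Poly_Mapping.single m c \<in> polys_upto I d"
    using assms by (auto simp: polys_upto_iff)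
  moreover have "poly_eval (Poly_Mapping.single m c) x = c * monom_eval m x" for x
    by (simp add: poly_eval_superset[of "{m}"])
  ultimately show ?thesis
    unfolding poly_fun_def by blast
qed

lemma poly_fun_const: "poly_fun I d (\<lambda>x. c)"
  using poly_fun_monom[of 0 I d c] by (simp add: monom_degree_def monom_eval_def)

lemma poly_fun_var: "v \<in> I \<Longrightarrow> 1 \<le> d \<Longrightarrow> poly_fun I d (\<lambda>x. x v)"
  using poly_fun_monom[of "Poly_Mapping.single v 1" I d 1]
  by (simp add: monom_degree_def monom_eval_def)

lemma poly_fun_add:
  assumes "poly_fun I d F" "poly_fun I d G"
  shows "poly_fun I d (\<lambda>x. F x + G x)"
proof -
  obtain p q where p: "p \<in> polys_upto I d" "\<And>x. poly_eval p x = F x"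
    and q: "q \<in> polys_upto I d" "\<And>x. poly_eval q x = G x"
    using assms by (auto simp: poly_fun_def)
  have "p + q \<in> polys_upto I d"
    using p q Poly_Mapping.keys_add[of p q] by (fastforce simp: polys_upto_iff)
  with p q show ?thesis
    unfolding poly_fun_def by (metis poly_eval_add)
qed

lemma poly_fun_sum:
  assumes "\<And>i. i \<in> A \<Longrightarrow> poly_fun I d (F i)"
  shows "poly_fun I d (\<lambda>x. \<Sum>i\<in>A. F i x)"
  using assms
  by (induction A rule: infinite_finite_induct) (auto intro: poly_fun_const poly_fun_add)

text \<open>Expanding into products of monomials bounds the degree term by term, without describing
  the keys of a product polynomial.\<close>

lemma poly_fun_mult:
  assumes "poly_fun I d F" "poly_fun I e G"
  shows "poly_fun I (d + e) (\<lambda>x. F x * G x)"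
proof -
  obtain p q where p: "p \<in> polys_upto I d" "\<And>x. F x = poly_eval p x"
    and q: "q \<in> polys_upto I e" "\<And>x. G x = poly_eval q x"
    using assms unfolding poly_fun_def by metis
  have "F x * G x = (\<Sum>m\<in>Poly_Mapping.keys p. \<Sum>m'\<in>Poly_Mapping.keys q.
      (Poly_Mapping.lookup p m * Poly_Mapping.lookup q m') * monom_eval (m + m') x)" for x
    by (simp add: p q poly_eval_def sum_product monom_eval_add mult_ac)
  moreover have "poly_fun I (d + e) (\<lambda>x. \<Sum>m\<in>Poly_Mapping.keys p. \<Sum>m'\<in>Poly_Mapping.keys q.
      (Poly_Mapping.lookup p m * Poly_Mapping.lookup q m') * monom_eval (m + m') x)"
  proof (intro poly_fun_sum poly_fun_monom)
    fix m m' assume m: "m \<in> Poly_Mapping.keys p" "m' \<in> Poly_Mapping.keys q"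
    show "Poly_Mapping.keys (m + m') \<subseteq> I"
      using m p(1) q(1) Poly_Mapping.keys_add[of m m'] unfolding polys_upto_iff by blast
    show "monom_degree (m + m') \<le> d + e"
      using m p(1) q(1) unfolding polys_upto_iff monom_degree_add by (blast intro: add_mono)
  qed
  ultimately show ?thesis by simp
qed

lemma poly_fun_mono: "poly_fun I d F \<Longrightarrow> d \<le> e \<Longrightarrow> poly_fun I e F"
  unfolding poly_fun_def by (fastforce simp: polys_upto_iff)

lemma poly_fun_cmult: "poly_fun I d F \<Longrightarrow> poly_fun I d (\<lambda>x. c * F x)"
  using poly_fun_mult[OF poly_fun_const[of I 0 c]] by simp

lemma poly_fun_diff: "poly_fun I d F \<Longrightarrow> poly_fun I d G \<Longrightarrow> poly_fun I d (\<lambda>x. F x - G x)"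
  using poly_fun_add[OF _ poly_fun_cmult[of I d G "-1"]] by simp

lemma poly_fun_prod:
  assumes "\<And>i. i \<in> A \<Longrightarrow> poly_fun I 1 (F i)"
  shows "poly_fun I (card A) (\<lambda>x. \<Prod>i\<in>A. F i x)"
  using assms
proof (induction A rule: infinite_finite_induct)
  case (insert a A)
  then show ?case
    using poly_fun_mult[of I 1 "F a" "card A"] by simp
qed (auto intro: poly_fun_const)

lemma poly_fun_poly:
  assumes "poly_fun I 1 G" "degree p \<le> d"
  shows "poly_fun I d (\<lambda>x. poly p (G x))"
proof -
  have "poly_fun I d (\<lambda>x. coeff p i * G x ^ i)" if "i \<le> degree p" for i
    using poly_fun_mono[OF poly_fun_prod[of "{..<i}" I "\<lambda>_. G"], of d] that assms
    by (intro poly_fun_cmult) auto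
  then show ?thesis
    unfolding poly_altdef by (intro poly_fun_sum) auto
qed

section \<open>Bounding \<open>R\<^sup>+\<close>\<close>

text \<open>The pair \<open>P\<close>, \<open>Q\<close> serves both claims: it bounds the infimum
  from above, and it makes the set nonempty, which the lower bound 0 requires.\<close>

lemma Rplus_bounds:
  assumes "finite X" "X \<noteq> {}"
    and "poly_fun I d P" "poly_fun I d Q" "\<And>x. x \<in> X \<Longrightarrow> Q x > 0"
    and "\<And>x. x \<in> X \<Longrightarrow> \<bar>f x - P x / Q x\<bar> \<le> b"
  shows "0 \<le> Rplus I X f d" "Rplus I X f d \<le> b"
proof -
  define S where "S = {Max ((\<lambda>x. \<bar>f x - poly_eval p x / poly_eval q x\<bar>) ` X) | p q.
            p \<in> polys_upto I d \<and> q \<in> polys_upto I d \<and> (\<forall>x\<in>X. poly_eval q x > 0)}"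
  obtain p q where "p \<in> polys_upto I d" "\<And>x. poly_eval p x = P x"
    and "q \<in> polys_upto I d" "\<And>x. poly_eval q x = Q x"
    using assms unfolding poly_fun_def by metis
  then have "Max ((\<lambda>x. \<bar>f x - P x / Q x\<bar>) ` X) \<in> S"
    unfolding S_def mem_Collect_eq using assms(5) by (intro exI[of _ p] exI[of _ q]) simp
  moreover have nonneg: "0 \<le> s" if s: "s \<in> S" for s
  proof -
    obtain x where "x \<in> X"
      using assms(2) by blast
    from s obtain p q where "s = Max ((\<lambda>x. \<bar>f x - poly_eval p x / poly_eval q x\<bar>) ` X)"
      by (auto simp: S_def)
    then have "\<bar>f x - poly_eval p x / poly_eval q x\<bar> \<le> s"
      using \<open>x \<in> X\<close> assms(1) by auto
    then show ?thesis
      by linarith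
  qed
  then have "bdd_below S"
    by (auto simp: bdd_below_def)
  ultimately have "Inf S \<le> Max ((\<lambda>x. \<bar>f x - P x / Q x\<bar>) ` X)" "0 \<le> Inf S"
    by (blast intro: cInf_lower cInf_greatest nonneg)+
  moreover have "Max ((\<lambda>x. \<bar>f x - P x / Q x\<bar>) ` X) \<le> b"
    using assms by auto
  ultimately show "0 \<le> Rplus I X f d" "Rplus I X f d \<le> b"
    unfolding Rplus_def S_def[symmetric] by linarith+
qed

text \<open>Since \<open>X\<close> is finite, pointwise limits are uniform: one small
  \<open>e\<close> works for all points. The infimum need not be attained.\<close>

lemma Rplus_eq_0_lim:
  assumes X: "finite X" "X \<noteq> {}"
    and PQ: "\<And>e::real. poly_fun I d (P e)" "\<And>e. poly_fun I d (Q e)"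
    and Q: "\<And>x. x \<in> X \<Longrightarrow> \<forall>\<^sub>F e in at_right 0. Q e x > 0"
    and lim: "\<And>x. x \<in> X \<Longrightarrow> ((\<lambda>e. P e x / Q e x) \<longlongrightarrow> f x) (at_right 0)"
  shows "Rplus I X f d = 0"
proof -
  have *: "0 \<le> Rplus I X f d \<and> Rplus I X f d \<le> b" if "b > 0" for b
  proof -
    have "\<forall>\<^sub>F e in at_right 0. \<bar>f x - P e x / Q e x\<bar> < b" if "x \<in> X" for x
      using tendstoD[OF lim[OF that] \<open>b > 0\<close>] by (simp add: dist_real_def abs_minus_commute)
    with Q have "\<forall>\<^sub>F e in at_right 0. \<forall>x\<in>X. Q e x > 0 \<and> \<bar>f x - P e x / Q e x\<bar> < b"
      using X by (auto simp: eventually_ball_finite_distrib eventually_conj_iff)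
    then obtain e where "\<forall>x\<in>X. Q e x > 0 \<and> \<bar>f x - P e x / Q e x\<bar> < b"
      using eventually_happens'[OF trivial_limit_at_right_real] by blast
    then show ?thesis
      using Rplus_bounds[OF X PQ, where f = f and b = b] by (metis less_imp_le)
  qed
  show ?thesis
    using *[of 1] *[of "Rplus I X f d / 2"] by linarith
qed

section \<open>Lexicographic limits and interpolation\<close>

text \<open>After cancelling \<open>e ^ m\<close>, the terms of index \<open>m\<close> dominate as
  \<open>e\<close> tends to 0; later coefficients may be arbitrary.\<close>

lemma tendsto_lexicographic_quotient:
  fixes a b :: "nat \<Rightarrow> real"
  assumes "m \<le> n" "\<And>l. l < m \<Longrightarrow> a l = 0" "\<And>l. l < m \<Longrightarrow> b l = 0" "b m = 1"
  shows "\<forall>\<^sub>F e in at_right 0. (\<Sum>l\<le>n. e ^ l * b l) > 0"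
    and "((\<lambda>e. (\<Sum>l\<le>n. e ^ l * a l) / (\<Sum>l\<le>n. e ^ l * b l)) \<longlongrightarrow> a m) (at_right 0)"
proof -
  have factor: "(\<Sum>l\<le>n. e ^ l * c l) = e ^ m * (\<Sum>l\<le>n - m. e ^ l * c (l + m))"
    if c: "\<And>l. l < m \<Longrightarrow> c l = 0" for c :: "nat \<Rightarrow> real" and e
  proof -
    have "(\<Sum>l\<le>n. e ^ l * c l) = (\<Sum>l\<in>{m..n}. e ^ l * c l)"
      by (rule sum.mono_neutral_right) (auto simp: c)
    also have "\<dots> = (\<Sum>l\<in>{0..n - m}. e ^ (l + m) * c (l + m))"
      using sum.shift_bounds_cl_nat_ivl[of "\<lambda>l. e ^ l * c l" 0 m "n - m"] assms(1) by simp
    finally show ?thesis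
      by (simp add: sum_distrib_left power_add mult_ac atMost_atLeast0)
  qed
  have lim: "((\<lambda>e. \<Sum>l\<le>n - m. e ^ l * c (l + m)) \<longlongrightarrow> c m) (at_right 0)"
    for c :: "nat \<Rightarrow> real"
  proof -
    have "((\<lambda>e. \<Sum>l\<le>n - m. e ^ l * c (l + m)) \<longlongrightarrow> (\<Sum>l\<le>n - m. 0 ^ l * c (l + m))) (at_right 0)"
      by (intro tendsto_intros)
    \<comment> \<open>Only \<open>l = 0\<close> survives, because \<open>0 ^ 0 = 1\<close>.\<close>
    also have "(\<Sum>l\<le>n - m. 0 ^ l * c (l + m)) = c m"
      by (simp add: power_0_left if_distrib[of "\<lambda>z. z * _"] cong: if_cong)
    finally show ?thesis .
  qed
  have "\<forall>\<^sub>F e in at_right 0. (\<Sum>l\<le>n - m. e ^ l * b (l + m)) > 0"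
    using order_tendstoD(1)[OF lim[of b], of 0] assms by simp
  moreover have pos: "\<forall>\<^sub>F e in at_right (0::real). e > 0"
    by (simp add: eventually_at_right_less)
  ultimately show "\<forall>\<^sub>F e in at_right 0. (\<Sum>l\<le>n. e ^ l * b l) > 0"
    by eventually_elim (simp add: factor assms)
  have "((\<lambda>e. (\<Sum>l\<le>n - m. e ^ l * a (l + m)) / (\<Sum>l\<le>n - m. e ^ l * b (l + m)))
      \<longlongrightarrow> a m) (at_right 0)"
    using tendsto_divide[OF lim[of a] lim[of b]] assms by simp
  moreover have "\<forall>\<^sub>F e in at_right 0.
      (\<Sum>l\<le>n - m. e ^ l * a (l + m)) / (\<Sum>l\<le>n - m. e ^ l * b (l + m)) =
      (\<Sum>l\<le>n. e ^ l * a l) / (\<Sum>l\<le>n. e ^ l * b l)"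
    using pos by eventually_elim (simp add: factor assms)
  ultimately show "((\<lambda>e. (\<Sum>l\<le>n. e ^ l * a l) / (\<Sum>l\<le>n. e ^ l * b l)) \<longlongrightarrow> a m) (at_right 0)"
    by (rule Lim_transform_eventually)
qed

text \<open>Newton interpolation: a multiple of the polynomial \<open>w\<close> vanishing on the old
  nodes corrects the value at the new one.\<close>

lemma poly_interpolation:
  fixes g :: "'a::field \<Rightarrow> 'a"
  assumes "finite S"
  shows "\<exists>p. degree p \<le> card S \<and> (\<forall>s\<in>S. poly p s = g s)"
  using assms
proof (induction S rule: finite_induct)
  case (insert a S)
  then obtain p where p: "degree p \<le> card S" "\<forall>s\<in>S. poly p s = g s"
    by blast
  define w where "w = (\<Prod>s\<in>S. [:-s, 1:])"
  define r where "r = p + smult ((g a - poly p a) / poly w a) w"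
  have "poly w a \<noteq> 0"
    using insert by (auto simp: w_def poly_prod)
  moreover have "poly w s = 0" if "s \<in> S" for s
    using insert that by (auto simp: w_def poly_prod intro!: prod_zero)
  moreover have "degree w \<le> card S"
    using degree_prod_sum_le[OF insert(1), of "\<lambda>s. [:-s, 1:]"] by (simp add: w_def)
  ultimately have "degree r \<le> card (insert a S) \<and> (\<forall>s\<in>insert a S. poly r s = g s)"
    using p insert by (auto simp: r_def intro!: degree_add_le order.trans[OF degree_smult_le])
  then show ?case by blast
qed (auto intro: exI[of _ 0])

section \<open>Newman's approximation of the sign function\<close>

lemma geometric_interval_cover:
  fixes N t :: real
  assumes "1 \<le> t" "t \<le> N ^ d" "1 \<le> d"
  shows "\<exists>i<d. N ^ i \<le> t \<and> t \<le> N ^ Suc i"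
  using assms(3,2)
proof (induction d rule: dec_induct)
  case base
  then show ?case using assms(1) by auto
next
  case (step d)
  then show ?case by (cases "t \<le> N ^ d") (auto intro: less_SucI)
qed

text \<open>Some node \<open>a\<close> is within a factor \<open>sqrt N\<close> of \<open>t\<close>,
  and its factor alone makes \<open>P (- t)\<close> small relative to \<open>P t\<close>. The
  constant \<open>2 * sqrt N / (N + 1)\<close> centres the resulting range of the quotient, from
  \<open>1 / sqrt N\<close> to \<open>sqrt N\<close>, around 1.\<close>

lemma newman_bound:
  fixes N t :: real and d :: nat
  defines "P \<equiv> \<lambda>t. \<Prod>i<d. t + N ^ i * sqrt N"
  assumes N: "1 \<le> N" and t: "1 \<le> t" "t \<le> N ^ d" and d: "1 \<le> d"
  shows "P t + P (- t) > 0"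
    and "\<bar>1 - (2 * sqrt N / (N + 1)) * (P t - P (- t)) / (P t + P (- t))\<bar> \<le> 1 - 1 / N"
proof -
  define s where "s = sqrt N"
  have s: "1 \<le> s" "N = s\<^sup>2"
    using N by (auto simp: s_def)
  obtain i where i: "i < d" "N ^ i \<le> t" "t \<le> N ^ Suc i"
    using geometric_interval_cover[OF t d] by blast
  define a where "a = N ^ i * s"
  have Ppos: "P t > 0"
    using N t unfolding P_def by (intro prod_pos) (auto intro: add_pos_nonneg)
  have split: "P u = (u + a) * (\<Prod>j\<in>{..<d} - {i}. u + N ^ j * s)" for u
    using i prod.remove[of "{..<d}" i "\<lambda>j. u + N ^ j * s"] by (simp add: P_def a_def s_def)
  have "a \<le> s * t" "t \<le> s * a"
    using i s by (auto simp: a_def power2_eq_square mult_ac)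
  \<comment> \<open>With \<open>a / t\<close> between \<open>1 / s\<close> and \<open>s\<close>, the
    ratio of \<open>\<bar>a - t\<bar>\<close> to \<open>t + a\<close> is largest at the
    endpoints.\<close>
  then have fac: "\<bar>a - t\<bar> * (s + 1) \<le> (s - 1) * (t + a)"
    by (cases "a \<ge> t") (auto simp: algebra_simps)
  \<comment> \<open>The remaining nodes are nonnegative, so none of their factors can enlarge the
    ratio.\<close>
  have rest: "\<bar>\<Prod>j\<in>{..<d} - {i}. - t + N ^ j * s\<bar> \<le> (\<Prod>j\<in>{..<d} - {i}. t + N ^ j * s)"
    unfolding abs_prod
  proof (rule prod_mono, safe)
    fix j
    have "0 \<le> N ^ j * s" using N s by simp
    then show "\<bar>- t + N ^ j * s\<bar> \<le> t + N ^ j * s" using t by linarith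
  qed simp
  have "\<bar>P (- t)\<bar> * (s + 1) = (\<bar>a - t\<bar> * (s + 1)) * \<bar>\<Prod>j\<in>{..<d} - {i}. - t + N ^ j * s\<bar>"
    by (simp add: split abs_mult)
  also have "\<dots> \<le> ((s - 1) * (t + a)) * (\<Prod>j\<in>{..<d} - {i}. t + N ^ j * s)"
    by (rule mult_mono[OF fac rest]) (use s t N in \<open>auto simp: a_def\<close>)
  finally have Q: "\<bar>P (- t)\<bar> * (s + 1) \<le> (s - 1) * P t"
    by (simp add: split)
  have "\<bar>P (- t)\<bar> * (s + 1) < P t * (s + 1)"
    using Q Ppos by (simp add: algebra_simps)
  then have "\<bar>P (- t)\<bar> < P t"
    using s by simp
  then show pos: "P t + P (- t) > 0"
    by linarith
  define R where "R = (P t - P (- t)) / (P t + P (- t))"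
  have "P (- t) * (s + 1) \<le> \<bar>P (- t)\<bar> * (s + 1)" "- P (- t) * (s + 1) \<le> \<bar>P (- t)\<bar> * (s + 1)"
    using s by (intro mult_right_mono; linarith)+
  with Q have "P t + P (- t) \<le> s * (P t - P (- t))" "P t - P (- t) \<le> s * (P t + P (- t))"
    by (auto simp: algebra_simps)
  then have R: "1 \<le> s * R" "R \<le> s"
    using pos by (auto simp: R_def field_simps)
  have "s * R \<le> s\<^sup>2"
    using R s by (simp add: power2_eq_square)
  then have "\<bar>N + 1 - 2 * (s * R)\<bar> \<le> N - 1"
    using R s by linarith
  moreover have "1 - (2 * s / (N + 1)) * R = (N + 1 - 2 * (s * R)) / (N + 1)"
    using N by (simp add: field_simps)
  ultimately have "\<bar>1 - (2 * s / (N + 1)) * R\<bar> \<le> (N - 1) / (N + 1)"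
    using N by (simp add: abs_divide divide_right_mono)
  also have "\<dots> \<le> 1 - 1 / N"
    using N by (simp add: field_simps)
  finally show "\<bar>1 - (2 * sqrt N / (N + 1)) * (P t - P (- t)) / (P t + P (- t))\<bar> \<le> 1 - 1 / N"
    by (simp add: R_def s_def)
qed

text \<open>The quotient is odd, which reduces negative \<open>t\<close> to the positive
  case.\<close>

lemma newman_bound_sgn:
  fixes N t :: real and d :: nat
  defines "P \<equiv> \<lambda>t. \<Prod>i<d. t + N ^ i * sqrt N"
  assumes N: "1 \<le> N" and t: "1 \<le> \<bar>t\<bar>" "\<bar>t\<bar> \<le> N ^ d" and d: "1 \<le> d"
  shows "P t + P (- t) > 0"
    and "\<bar>sgn t - (2 * sqrt N / (N + 1)) * (P t - P (- t)) / (P t + P (- t))\<bar> \<le> 1 - 1 / N"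
proof -
  have "P t + P (- t) > 0 \<and>
    \<bar>sgn t - (2 * sqrt N / (N + 1)) * (P t - P (- t)) / (P t + P (- t))\<bar> \<le> 1 - 1 / N"
  proof (cases "t > 0")
    case True
    then show ?thesis
      using newman_bound[OF N _ _ d, of t] t by (simp add: P_def)
  next
    case False
    have "\<bar>sgn t - (2 * sqrt N / (N + 1)) * (P t - P (- t)) / (P t + P (- t))\<bar> =
      \<bar>1 - (2 * sqrt N / (N + 1)) * (P (- t) - P t) / (P (- t) + P t)\<bar>"
    proof -
      have "sgn t = - 1" using False t by (simp add: sgn_if)
      moreover have "(2 * sqrt N / (N + 1)) * (P t - P (- t)) / (P t + P (- t)) =
          - ((2 * sqrt N / (N + 1)) * (P (- t) - P t) / (P (- t) + P t))"
        by (simp add: minus_divide_left[symmetric] add.commute flip: minus_mult_right)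
           (metis minus_diff_eq minus_divide_left mult_minus_right)
      ultimately show ?thesis by linarith
    qed
    then show ?thesis
      using newman_bound[OF N _ _ d, of "- t"] t False by (simp add: P_def add.commute)
  qed
  then show "P t + P (- t) > 0"
    "\<bar>sgn t - (2 * sqrt N / (N + 1)) * (P t - P (- t)) / (P t + P (- t))\<bar> \<le> 1 - 1 / N"
    by auto
qed

section \<open>Prefixes of a weighted sum\<close>

text \<open>The value after step \<open>l\<close> of Horner's rule at 2, with \<open>c 0\<close> as
  leading coefficient.\<close>

definition binary_prefix :: "(nat \<Rightarrow> real) \<Rightarrow> nat \<Rightarrow> real" where
  "binary_prefix c l = (\<Sum>j\<le>l. 2 ^ (l - j) * c j)"

lemma binary_prefix_0: "binary_prefix c 0 = c 0"
  by (simp add: binary_prefix_def)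

lemma binary_prefix_Suc: "binary_prefix c (Suc l) = 2 * binary_prefix c l + c (Suc l)"
proof -
  have "(\<Sum>j\<le>l. 2 ^ (Suc l - j) * c j) = 2 * (\<Sum>j\<le>l. 2 ^ (l - j) * c j)"
    unfolding sum_distrib_left by (rule sum.cong) (auto simp: Suc_diff_le)
  then show ?thesis
    by (simp add: binary_prefix_def)
qed

text \<open>A prefix of absolute value at least \<open>K\<close> is doubled and then changed by at
  most \<open>K\<close>, so it stays at least \<open>K\<close> away from 0 on the same side.\<close>

lemma sgn_binary_prefix_decided:
  assumes c: "\<And>j. \<bar>c j\<bar> \<le> K" and "K > 0" and "K \<le> \<bar>binary_prefix c m\<bar>" and "m \<le> l"
  shows "sgn (binary_prefix c l) = sgn (binary_prefix c m)"
proof (cases "binary_prefix c m > 0")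
  case True
  have "K \<le> binary_prefix c l"
    using \<open>m \<le> l\<close>
  proof (induction l rule: dec_induct)
    case (step i)
    then show ?case using c[of "Suc i"] by (simp add: binary_prefix_Suc)
  qed (use True assms in auto)
  with True \<open>K > 0\<close> show ?thesis by simp
next
  case False
  have "binary_prefix c l \<le> - K"
    using \<open>m \<le> l\<close>
  proof (induction l rule: dec_induct)
    case (step i)
    then show ?case using c[of "Suc i"] by (simp add: binary_prefix_Suc)
  qed (use False assms in auto)
  with False assms show ?thesis by (simp add: sgn_if)
qed

text \<open>The bound \<open>3 * K\<close> comes from one Horner step: the previous prefix is below
  \<open>K\<close>, and doubling it and adding a coefficient gives less than
  \<open>2 * K + K\<close>.\<close>

lemma binary_prefix_first_decided:
  assumes c: "\<And>j. \<bar>c j\<bar> \<le> K" and K: "K > 0"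
  obtains m where "m \<le> n" "\<And>l. l < m \<Longrightarrow> \<bar>binary_prefix c l\<bar> < K"
    "\<bar>binary_prefix c m\<bar> < 3 * K" "m = n \<or> K \<le> \<bar>binary_prefix c m\<bar>"
    "sgn (binary_prefix c m) = sgn (binary_prefix c n)"
proof -
  \<comment> \<open>Index \<open>n\<close> always counts as a stop, as the threshold
    \<open>K\<close> may never be reached.\<close>
  define D where "D m \<longleftrightarrow> m = n \<or> K \<le> \<bar>binary_prefix c m\<bar>" for m
  define m where "m = (LEAST m. D m)"
  have "D n" by (simp add: D_def)
  then have m: "D m" "m \<le> n"
    unfolding m_def by (rule LeastI, rule Least_le)
  have before: "\<bar>binary_prefix c l\<bar> < K" if "l < m" for l
    using not_less_Least[of l D] that by (auto simp: D_def m_def)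
  have "\<bar>binary_prefix c m\<bar> < 3 * K"
  proof (cases m)
    case 0
    then show ?thesis using c[of 0] K by (simp add: binary_prefix_0)
  next
    case (Suc i)
    then show ?thesis
      using before[of i] c[of m] by (auto simp: binary_prefix_Suc)
  qed
  moreover have "sgn (binary_prefix c m) = sgn (binary_prefix c n)"
    using m c K sgn_binary_prefix_decided[of c K m n] by (auto simp: D_def)
  ultimately show ?thesis
    using that m before unfolding D_def by blast
qed

section \<open>The halfspace\<close>

text \<open>The coefficient of \<open>2\<^sup>n\<^sup>-\<^sup>j\<close> in the argument of \<open>sgn\<close>; the truncated subtraction makes every
  \<open>j \<ge> n\<close> stand for the constant term \<open>1\<close>.\<close>

definition layer :: "nat \<Rightarrow> nat \<Rightarrow> (nat \<times> nat \<Rightarrow> real) \<Rightarrow> nat \<Rightarrow> real" where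
  "layer n k x j = (if n - j = 0 then 1 else \<Sum>i=1..k. x (n - j, i))"

text \<open>The layers run from the most significant one down, so the sum is reversed by
  \<open>i = n - j\<close>.\<close>

lemma halfspace_eq_sgn_prefix: "halfspace n k x = sgn (binary_prefix (layer n k x) n)"
proof -
  define s where "s i = (if i = 0 then 1 else \<Sum>j=1..k. x (i, j))" for i
  have "binary_prefix (layer n k x) n = (\<Sum>j\<le>n. 2 ^ (n - j) * s (n - j))"
    unfolding binary_prefix_def layer_def s_def by simp
  also have "\<dots> = (\<Sum>i\<le>n. 2 ^ i * s i)"
    by (rule sum.reindex_bij_witness[of _ "\<lambda>i. n - i" "\<lambda>i. n - i"]) auto
  also have "\<dots> = 1 + (\<Sum>i=1..n. 2 ^ i * s i)"
    by (simp add: atMost_atLeast0 sum.atLeast_Suc_atMost s_def)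
  also have "(\<Sum>i=1..n. 2 ^ i * s i) = (\<Sum>i=1..n. \<Sum>j=1..k. 2 ^ i * x (i, j))"
    by (rule sum.cong) (auto simp: s_def sum_distrib_left)
  finally show ?thesis
    by (simp add: halfspace_def)
qed

lemma sign_cube_cases:
  assumes "x \<in> sign_cube I" "v \<in> I"
  shows "x v = -1 \<or> x v = 1"
  using assms by (auto simp: sign_cube_def PiE_def Pi_def)

lemma layer_bound:
  assumes "x \<in> sign_cube ({1..n} \<times> {1..k})" "k \<ge> 1"
  shows "\<bar>layer n k x j\<bar> \<le> real k"
proof (cases "n - j = 0")
  case False
  have "\<bar>x (n - j, i)\<bar> \<le> 1" if "i \<in> {1..k}" for i
    using sign_cube_cases[OF assms(1), of "(n - j, i)"] that False by auto
  then have "\<bar>\<Sum>i=1..k. x (n - j, i)\<bar> \<le> (\<Sum>i=1..k. 1)"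
    by (intro order.trans[OF sum_abs] sum_mono)
  then show ?thesis
    using False by (simp add: layer_def)
qed (use assms in \<open>simp add: layer_def\<close>)

lemma layer_Ints:
  assumes "x \<in> sign_cube ({1..n} \<times> {1..k})"
  shows "layer n k x j \<in> \<int>"
proof (cases "n - j = 0")
  case False
  have "x (n - j, i) \<in> \<int>" if "i \<in> {1..k}" for i
    using sign_cube_cases[OF assms, of "(n - j, i)"] that False by auto
  then show ?thesis
    using False by (auto simp: layer_def intro!: Ints_sum)
qed (simp add: layer_def)

lemma binary_prefix_layer_Ints:
  assumes "x \<in> sign_cube ({1..n} \<times> {1..k})"
  shows "binary_prefix (layer n k x) l \<in> \<int>"
  unfolding binary_prefix_def
  by (intro Ints_sum Ints_mult Ints_power layer_Ints[OF assms]) auto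

lemma poly_fun_prefix:
  "poly_fun ({1..n} \<times> {1..k}) 1 (\<lambda>x. binary_prefix (layer n k x) l)"
proof -
  have "poly_fun ({1..n} \<times> {1..k}) 1 (\<lambda>x. layer n k x j)" for j
  proof (cases "n - j = 0")
    case False
    then show ?thesis
      by (auto simp: layer_def intro!: poly_fun_sum poly_fun_var)
  qed (simp add: layer_def poly_fun_const)
  then show ?thesis
    unfolding binary_prefix_def by (intro poly_fun_sum poly_fun_cmult)
qed

lemma halfspace_argument_bounds:
  assumes x: "x \<in> sign_cube ({1..n} \<times> {1..k})" and k: "k \<ge> 1"
  shows "1 \<le> \<bar>binary_prefix (layer n k x) n\<bar>"
    and "\<bar>binary_prefix (layer n k x) n\<bar> \<le> real k * 2 ^ (n + 1)"
proof -
  have "binary_prefix (layer n k x) n \<noteq> 0"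
    using halfspace_range[OF x] by (auto simp: halfspace_eq_sgn_prefix)
  then show "1 \<le> \<bar>binary_prefix (layer n k x) n\<bar>"
    using binary_prefix_layer_Ints[OF x] by (intro Ints_nonzero_abs_ge1)
  \<comment> \<open>Subtracting 1 makes the bound inductive: twice \<open>2 ^ (l + 1) - 1\<close>,
    plus 1, is \<open>2 ^ (l + 2) - 1\<close>.\<close>
  have "\<bar>binary_prefix (layer n k x) l\<bar> \<le> real k * (2 ^ (l + 1) - 1)" for l
  proof (induction l)
    case 0
    then show ?case using layer_bound[OF x k, of 0] by (simp add: binary_prefix_0)
  next
    case (Suc l)
    then show ?case
      using layer_bound[OF x k, of "Suc l"] by (simp add: binary_prefix_Suc algebra_simps)
  qed
  from this[of n] show "\<bar>binary_prefix (layer n k x) n\<bar> \<le> real k * 2 ^ (n + 1)"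
    by (simp add: algebra_simps)
qed

lemma sign_cube_finite_nonempty:
  "finite I \<Longrightarrow> finite (sign_cube I)" "sign_cube I \<noteq> {}"
  by (auto simp: sign_cube_def finite_PiE PiE_eq_empty_iff)

section \<open>The bound for every degree\<close>

lemma Rplus_halfspace_le:
  assumes k: "k \<ge> 1" and d: "d \<ge> 1"
  shows "Rplus ({1..n} \<times> {1..k}) (sign_cube ({1..n} \<times> {1..k})) (halfspace n k) d
           \<le> 1 - (real k * 2 ^ (n + 1)) powr (- 1 / real d)"
proof -
  define M where "M = real k * 2 ^ (n + 1)"
  \<comment> \<open>Chosen so that \<open>N ^ d = M\<close>: the \<open>d\<close> geometric
    intervals then exactly cover the range from 1 to \<open>M\<close>.\<close>
  define N where "N = M powr (1 / real d)"
  have M: "1 \<le> M"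
    using mult_mono[of 1 "real k" 1 "2 ^ (n + 1)"] k one_le_power[of "2::real" "n + 1"]
    by (simp add: M_def del: power_Suc)
  then have N: "1 \<le> N" "N ^ d = M"
    using d by (auto simp: N_def ge_one_powr_ge_zero powr_powr simp flip: powr_realpow)
  define P where "P t = (\<Prod>i<d. t + N ^ i * sqrt N)" for t
  define T where "T x = binary_prefix (layer n k x) n" for x
  note T = poly_fun_prefix[of n k n, folded T_def]
  have P: "poly_fun ({1..n} \<times> {1..k}) d (\<lambda>x. P (T x))"
    using poly_fun_prod[of "{..<d}", OF poly_fun_add[OF T poly_fun_const]]
    by (simp add: P_def)
  have P': "poly_fun ({1..n} \<times> {1..k}) d (\<lambda>x. P (- T x))"
    using poly_fun_prod[of "{..<d}", OF poly_fun_add[OF poly_fun_cmult[OF T, of "-1"] poly_fun_const]]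
    by (simp add: P_def)
  have "Rplus ({1..n} \<times> {1..k}) (sign_cube ({1..n} \<times> {1..k})) (halfspace n k) d \<le> 1 - 1 / N"
  proof (rule Rplus_bounds(2)[OF _ _ poly_fun_cmult[OF poly_fun_diff[OF P P'],
          of "2 * sqrt N / (N + 1)"] poly_fun_add[OF P P']])
    fix x assume x: "x \<in> sign_cube ({1..n} \<times> {1..k})"
    note b = newman_bound_sgn[OF N(1) _ _ d, of "T x", folded P_def]
    show "P (T x) + P (- T x) > 0"
      using halfspace_argument_bounds[OF x k] N by (intro b(1)) (simp_all add: T_def M_def)
    show "\<bar>halfspace n k x - 2 * sqrt N / (N + 1) * (P (T x) - P (- T x)) / (P (T x) + P (- T x))\<bar>
        \<le> 1 - 1 / N"
      unfolding halfspace_eq_sgn_prefix T_def[symmetric]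
      using halfspace_argument_bounds[OF x k] N by (intro b(2)) (simp_all add: T_def M_def)
  qed (auto simp: sign_cube_finite_nonempty)
  also have "1 / N = M powr (- 1 / real d)"
    by (simp add: N_def powr_minus_divide)
  finally show ?thesis
    by (simp add: M_def)
qed

section \<open>Error zero\<close>

text \<open>For \<open>k = 1\<close> the leading layer is a single sign and already reaches the
  threshold 1, so the halfspace is the coordinate \<open>x (n, 1)\<close>.\<close>

lemma Rplus_halfspace_one_eq_0:
  assumes "n \<ge> 1" "d \<ge> 1"
  shows "Rplus ({1..n} \<times> {1..1}) (sign_cube ({1..n} \<times> {1..1})) (halfspace n 1) d = 0"
proof -
  have "halfspace n 1 x = x (n, 1)" if x: "x \<in> sign_cube ({1..n} \<times> {1..1})" for x
  proof -
    have c: "\<bar>layer n 1 x j\<bar> \<le> 1" for j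
      using layer_bound[OF x] by simp
    have pm: "x (n, 1) = -1 \<or> x (n, 1) = 1"
      using sign_cube_cases[OF x, of "(n, 1)"] assms by simp
    have first: "binary_prefix (layer n 1 x) 0 = x (n, 1)"
      using assms by (simp add: binary_prefix_0 layer_def)
    then have "sgn (binary_prefix (layer n 1 x) n) = sgn (x (n, 1))"
      using sgn_binary_prefix_decided[of "layer n 1 x" 1 0 n] c pm by auto
    then show ?thesis
      using pm by (auto simp: halfspace_eq_sgn_prefix)
  qed
  then show ?thesis
    using assms
    by (intro Rplus_eq_0_lim[where P = "\<lambda>_ x. x (n, 1)" and Q = "\<lambda>_ _. 1"])
      (auto simp: sign_cube_finite_nonempty intro: poly_fun_var poly_fun_const)
qed

lemma Rplus_halfspace_eq_0:
  assumes k: "k \<ge> 1" and d: "d \<ge> 6 * k"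
  shows "Rplus ({1..n} \<times> {1..k}) (sign_cube ({1..n} \<times> {1..k})) (halfspace n k) d = 0"
proof -
  \<comment> \<open>These \<open>6 * k - 1\<close> integers include every prefix up to and including
    the first decided one.\<close>
  define S where "S = real_of_int ` {- 3 * int k<..<3 * int k}"
  have S: "finite S" "card S \<le> 6 * k"
    by (simp_all add: S_def card_image inj_on_def)
  define g where "g t = (if \<bar>t\<bar> < real k then 0 else sgn t)" for t
  define h where "h t = (if \<bar>t\<bar> < real k then 0 else 1 :: real)" for t
  obtain pa where pa: "degree pa \<le> card S" "\<forall>s\<in>S. poly pa s = g s"
    using poly_interpolation[OF S(1)] by blast
  obtain pb where pb: "degree pb \<le> card S" "\<forall>s\<in>S. poly pb s = h s"
    using poly_interpolation[OF S(1)] by blast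
  obtain pc where pc: "degree pc \<le> card S" "\<forall>s\<in>S. poly pc s = sgn s"
    using poly_interpolation[OF S(1)] by blast
  define U where "U x = binary_prefix (layer n k x)" for x
  \<comment> \<open>The last layer must answer even below the threshold, hence \<open>pc\<close> and
    denominator 1 there. Values at prefixes outside \<open>S\<close> are uncontrolled, but occur
    only after the deciding index.\<close>
  define a where "a l x = poly (if l = n then pc else pa) (U x l)" for l x
  define b where "b l x = poly (if l = n then 1 else pb) (U x l)" for l x
  have "poly_fun ({1..n} \<times> {1..k}) d (a l)" "poly_fun ({1..n} \<times> {1..k}) d (b l)" for l
    unfolding a_def b_def U_def
    by (rule poly_fun_poly[OF poly_fun_prefix], use pa pb pc S d in simp)+
  then have ab: "poly_fun ({1..n} \<times> {1..k}) d (\<lambda>x. \<Sum>l\<le>n. e ^ l * a l x)"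
    "poly_fun ({1..n} \<times> {1..k}) d (\<lambda>x. \<Sum>l\<le>n. e ^ l * b l x)" for e
    by (auto intro!: poly_fun_sum poly_fun_cmult)
  have lim: "(\<forall>\<^sub>F e in at_right 0. (\<Sum>l\<le>n. e ^ l * b l x) > 0) \<and>
      ((\<lambda>e. (\<Sum>l\<le>n. e ^ l * a l x) / (\<Sum>l\<le>n. e ^ l * b l x)) \<longlongrightarrow> halfspace n k x) (at_right 0)"
    if x: "x \<in> sign_cube ({1..n} \<times> {1..k})" for x
  proof -
    have SI: "U x l \<in> S" if "\<bar>U x l\<bar> < 3 * real k" for l
    proof -
      obtain z where "U x l = of_int z"
        using binary_prefix_layer_Ints[OF x, of l] by (auto simp: U_def elim: Ints_cases)
      moreover from this have "\<bar>z\<bar> < 3 * int k"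
        using that by linarith
      ultimately show ?thesis
        by (force simp: S_def)
    qed
    obtain m where m: "m \<le> n" "\<And>l. l < m \<Longrightarrow> \<bar>U x l\<bar> < k"
      "\<bar>U x m\<bar> < 3 * real k" "m = n \<or> k \<le> \<bar>U x m\<bar>" "sgn (U x m) = sgn (U x n)"
      using binary_prefix_first_decided[of "layer n k x" "real k" n] layer_bound[OF x k] k
      unfolding U_def by auto
    \<comment> \<open>Here \<open>l < m\<close> and \<open>m \<le> n\<close> exclude the special
      last layer, so both interpolants give 0.\<close>
    have before: "a l x = 0 \<and> b l x = 0" if "l < m" for l
    proof -
      have "U x l \<in> S"
        using m(2)[OF that] by (intro SI) linarith
      then show ?thesis
        using that m(1,2) pa pb by (auto simp: a_def b_def g_def h_def)
    qed
    have "a m x = halfspace n k x" "b m x = 1"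
      using SI[OF m(3)] m pa pb pc
      by (auto simp: a_def b_def g_def h_def halfspace_eq_sgn_prefix U_def)
    then show ?thesis
      using tendsto_lexicographic_quotient[OF m(1), of "\<lambda>l. a l x" "\<lambda>l. b l x"] before by simp
  qed
  show ?thesis
    using lim ab
    by (intro Rplus_eq_0_lim[where P = "\<lambda>e x. \<Sum>l\<le>n. e ^ l * a l x"
          and Q = "\<lambda>e x. \<Sum>l\<le>n. e ^ l * b l x"])
      (auto simp: sign_cube_finite_nonempty)
qed

theorem theorem4p2:
  fixes n k :: nat
  assumes "n \<ge> 1" and "k \<ge> 1"
  shows "Rplus ({1..n} \<times> {1..k}) (sign_cube ({1..n} \<times> {1..k})) (halfspace n k)
           (64 * k * nat \<lceil>log 2 (real k)\<rceil> + 1) = 0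
       \<and> (\<forall>d::nat. d \<ge> 1 \<longrightarrow>
            Rplus ({1..n} \<times> {1..k}) (sign_cube ({1..n} \<times> {1..k})) (halfspace n k) d
              \<le> 1 - (real k * 2 ^ (n + 1)) powr (- 1 / real d))"
proof (intro conjI allI impI)
  show "Rplus ({1..n} \<times> {1..k}) (sign_cube ({1..n} \<times> {1..k})) (halfspace n k)
           (64 * k * nat \<lceil>log 2 (real k)\<rceil> + 1) = 0"
  \<comment> \<open>For \<open>k = 1\<close> the logarithm is 0 and only degree 1 is available; for
    larger \<open>k\<close> its ceiling is at least 1, and \<open>64 * k\<close> exceeds the
    required \<open>6 * k\<close>.\<close>
  proof (cases "k = 1")
    case True
    then show ?thesis
      using Rplus_halfspace_one_eq_0[OF assms(1)] by simp
  next
    case False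
    with assms have "0 < log 2 (real k)"
      by simp
    then have "1 \<le> nat \<lceil>log 2 (real k)\<rceil>"
      by linarith
    then have "6 * k * 1 \<le> 64 * k * nat \<lceil>log 2 (real k)\<rceil>"
      by (intro mult_mono) auto
    then have "6 * k \<le> 64 * k * nat \<lceil>log 2 (real k)\<rceil> + 1"
      by linarith
    then show ?thesis
      by (rule Rplus_halfspace_eq_0[OF assms(2)])
  qed
qed (rule Rplus_halfspace_le[OF assms(2)])

end
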